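(* Let $k\in(0,1)$, let $f\in\mathcal{H}_{k}(\mathbb{B}^{n})$ and suppose $|f(z)|<1$ for all $z\in\mathbb{B}^{n}$. Then for each $\theta\in\partial\mathbb{B}^{n}$ and each $z\in\mathbb{B}^n$, $$|\nabla \overline{f}(z)\cdot\theta|+|\nabla f(z)\cdot\overline{\theta}|\leq K\,\frac{1-|f(z)|^{2}}{1-|z|^{2}},\qquad K=\frac{1+k}{1-k}.$$
   Context: For $z,w\in\mathbb{C}^n$, $z\cdot w=\langle z,w\rangle=\sum_{j=1}^n z_j\overline{w}_j$, $|z|=\langle z,z\rangle^{1/2}$, $\overline z=(\overline z_1,\dots,\overline z_n)$, and $\mathbb{B}^n=\{z\in\mathbb{C}^n:|z|<1\}$. A continuous complex-valued function $f$ on a domain $G\subset\mathbb{C}^n$ is pluriharmonic if for each $z\in G$ and $\theta\in\partial\mathbb{B}^n$ the function $\zeta\mapsto f(z+\theta\zeta)$ is harmonic in $\{\zeta\in\mathbb{C}:|\zeta|<d_G(z)\}$, where $d_G(z)$ is the distance from $z$ to $\partial G$. Notation: $\nabla f=(f_{z_1},\dots,f_{z_n})$ and $\nabla\overline f=(f_{\overline z_1},\dots,f_{\overline z_n})$ (the latter is the notation for the vector of $\overline z_j$-derivatives of $f$ itself). Thus $\nabla f\cdot\overline\theta=\sum_j f_{z_j}\theta_j$ and $\nabla\overline f\cdot\theta=\sum_j f_{\overline z_j}\overline{\theta}_j$. For a proper domain $G$ of $\mathbb{C}^n$ and a constant $k\in(0,1)$, $\mathcal{H}_k(G)$ is the class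 of all pluriharmonic mappings $f=h+\overline g$ from $G$ into $\mathbb{C}$, with $h,g$ holomorphic in $G$, such that for every $\theta\in\partial\mathbb{B}^n$ and $z\in G$, $|\nabla\overline f(z)\cdot\theta|\le k\,|\nabla f(z)\cdot\overline\theta|$. *)

theory Defs
  imports "HOL-Analysis.Analysis"
begin

definition hinner :: "complex ^ 'n \<Rightarrow> complex ^ 'n \<Rightarrow> complex" where
  "hinner z w = (\<Sum>j\<in>UNIV. z $ j * cnj (w $ j))"

definition cnj_vec :: "complex ^ 'n \<Rightarrow> complex ^ 'n" where
  "cnj_vec z = (\<chi> j. cnj (z $ j))"

text \<open>Directional derivative of \<open>f\<close> at \<open>z\<close> along \<open>v\<close>, with a real parameter.\<close>

definition ddir :: "'a::real_normed_vector \<Rightarrow> ('a \<Rightarrow> complex) \<Rightarrow> 'a \<Rightarrow> complex" where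
  "ddir v f z = vector_derivative (\<lambda>t. f (z + t *\<^sub>R v)) (at 0)"

text \<open>Writing \<open>z\<^sub>j = x\<^sub>j + i y\<^sub>j\<close>, the directions \<open>axis j 1\<close> and \<open>axis j \<i>\<close> give the partial
  derivatives in \<open>x\<^sub>j\<close> and \<open>y\<^sub>j\<close>, so the components below are the Wirtinger derivatives of \<open>f\<close>
  with respect to \<open>z\<^sub>j\<close> and to its conjugate.  Note that \<open>grad_bar f\<close> differentiates \<open>f\<close> itself,
  not its complex conjugate.\<close>

definition grad :: "(complex ^ 'n \<Rightarrow> complex) \<Rightarrow> complex ^ 'n \<Rightarrow> complex ^ 'n" where
  "grad f z = (\<chi> j. (ddir (axis j 1) f z - \<i> * ddir (axis j \<i>) f z) / 2)"

definition grad_bar :: "(complex ^ 'n \<Rightarrow> complex) \<Rightarrow> complex ^ 'n \<Rightarrow> complex ^ 'n" where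
  "grad_bar f z = (\<chi> j. (ddir (axis j 1) f z + \<i> * ddir (axis j \<i>) f z) / 2)"

text \<open>Holomorphy in several variables on an open set: complex differentiability, i.e. a Frechet
  derivative that is linear over the complex numbers.\<close>

definition holomorphic_vec_on :: "(complex ^ 'n \<Rightarrow> complex) \<Rightarrow> (complex ^ 'n) set \<Rightarrow> bool" where
  "holomorphic_vec_on f G \<longleftrightarrow>
     (\<forall>z\<in>G. \<exists>c :: complex ^ 'n. (f has_derivative (\<lambda>v. \<Sum>j\<in>UNIV. c $ j * v $ j)) (at z))"

text \<open>Harmonic on an open subset of the plane: twice continuously (real) differentiable, with
  vanishing Laplacian.\<close>

definition C1_on :: "(complex \<Rightarrow> complex) \<Rightarrow> complex set \<Rightarrow> bool" where
  "C1_on u S \<longleftrightarrow> (\<forall>z\<in>S. u differentiable (at z)) \<and>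
     continuous_on S (ddir 1 u) \<and> continuous_on S (ddir \<i> u)"

definition harmonic_on :: "(complex \<Rightarrow> complex) \<Rightarrow> complex set \<Rightarrow> bool" where
  "harmonic_on u S \<longleftrightarrow> C1_on u S \<and> C1_on (ddir 1 u) S \<and> C1_on (ddir \<i> u) S \<and>
     (\<forall>z\<in>S. ddir 1 (ddir 1 u) z + ddir \<i> (ddir \<i> u) z = 0)"

text \<open>The definitions below are meant for a domain \<open>G\<close> other than the whole space: then
  \<open>frontier G\<close> is nonempty, and \<open>infdist z (frontier G)\<close> is the distance from \<open>z\<close> to the
  boundary of \<open>G\<close>.\<close>

definition pluriharmonic_on :: "(complex ^ 'n \<Rightarrow> complex) \<Rightarrow> (complex ^ 'n) set \<Rightarrow> bool" where
  "pluriharmonic_on f G \<longleftrightarrow> continuous_on G f \<and>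
     (\<forall>z\<in>G. \<forall>\<theta>\<in>sphere 0 1.
        harmonic_on (\<lambda>\<zeta>. f (z + \<zeta> *s \<theta>)) {\<zeta>. cmod \<zeta> < infdist z (frontier G)})"

definition pluriharmonic_class ::
    "real \<Rightarrow> (complex ^ 'n) set \<Rightarrow> (complex ^ 'n \<Rightarrow> complex) set" where
  "pluriharmonic_class k G = {f. pluriharmonic_on f G \<and>
     (\<exists>h g. holomorphic_vec_on h G \<and> holomorphic_vec_on g G \<and>
        (\<forall>z\<in>G. f z = h z + cnj (g z))) \<and>
     (\<forall>\<theta>\<in>sphere 0 1. \<forall>z\<in>G.
        cmod (hinner (grad_bar f z) \<theta>) \<le> k * cmod (hinner (grad f z) (cnj_vec \<theta>)))}"

end

theory Submission
  imports Defs "HOL-Complex_Analysis.Cauchy_Integral_Formula"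
begin

text \<open>
  The proof is an Ahlfors--Schwarz argument on complex lines.  Fix a unit vector \<open>\<theta>\<close>.  Along a
  line in direction \<open>\<theta>\<close> the map is \<open>F = H + cnj G\<close> with \<open>H\<close>, \<open>G\<close> holomorphic on a disc, and
  the two quantities to be bounded are \<open>\<bar>H'\<bar>\<close> and \<open>\<bar>G'\<bar> \<le> k \<bar>H'\<bar>\<close>.  It is therefore enough to
  bound \<open>(1 + k) \<bar>H'\<bar>\<close>.

  In the disc of radius \<open>\<rho>\<close>, pull the hyperbolic density of the target back by \<open>F\<close>, but keep
  only the factor \<open>\<bar>H'\<bar>\<close> of the differential, and compare with the hyperbolic density of the
  disc: the quotient is, up to a constant, \<open>\<bar>H'\<bar> (\<rho>\<^sup>2 - \<bar>\<zeta>\<bar>\<^sup>2) / (1 - \<bar>F\<bar>\<^sup>2)\<close>.  It vanishes on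
  the boundary, so unless it is identically zero it has a positive maximum inside, where
  \<open>H' \<noteq> 0\<close> and the Laplacian of its logarithm is not positive.  The term \<open>ln \<bar>H'\<bar>\<close> is
  harmonic there, the term \<open>ln (\<rho>\<^sup>2 - \<bar>\<zeta>\<bar>\<^sup>2)\<close> has Laplacian
  \<open>- 4 \<rho>\<^sup>2 / (\<rho>\<^sup>2 - \<bar>\<zeta>\<bar>\<^sup>2)\<^sup>2\<close>, and quasiregularity makes the Laplacian of \<open>- ln (1 - \<bar>F\<bar>\<^sup>2)\<close> at
  least \<open>4 (1 - k)\<^sup>2 \<bar>H'\<bar>\<^sup>2 / (1 - \<bar>F\<bar>\<^sup>2)\<^sup>2\<close>.  So the quotient is at most \<open>\<rho> / (1 - k)\<close> at its
  maximum, hence everywhere (lemma \<open>schwarz_pick_subdisc\<close>), and \<open>\<rho>\<close> tends to the full radius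
  (lemma \<open>schwarz_pick_disc\<close>).

  The line through \<open>z\<close> in direction \<open>\<theta>\<close> meets the unit ball in a disc of radius \<open>r \<le> 1\<close> about
  the point \<open>a\<close> of the line that is closest to the origin, and \<open>r\<^sup>2 - \<bar>\<zeta>\<bar>\<^sup>2 = 1 - \<bar>z\<bar>\<^sup>2\<close> for
  \<open>z = a + \<zeta> \<theta>\<close>.  The bound on this disc is \<open>(1 - k) \<bar>H'\<bar> \<le> r (1 - \<bar>f\<bar>\<^sup>2) / (1 - \<bar>z\<bar>\<^sup>2)\<close>,
  and \<open>r \<le> 1\<close> turns it into the bound on the ball.
\<close>

section \<open>Second derivatives at the origin of the real line\<close>

definition jet2 :: "(real \<Rightarrow> real) \<Rightarrow> real \<Rightarrow> real \<Rightarrow> bool" where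
  "jet2 f c d \<longleftrightarrow> (\<exists>f'. (\<forall>\<^sub>F t in nhds 0. (f has_real_derivative f' t) (at t)) \<and>
      f' 0 = c \<and> (f' has_real_derivative d) (at 0))"

lemma jet2I:
  assumes "\<forall>\<^sub>F t in nhds 0. (f has_real_derivative f' t) (at t)"
    and "f' 0 = c" and "(f' has_real_derivative d) (at 0)"
  shows "jet2 f c d"
  using assms unfolding jet2_def by blast

lemma jet2_const: "jet2 (\<lambda>t. c) 0 0"
  by (rule jet2I[where f' = "\<lambda>t. 0"]) auto

lemma jet2_add:
  assumes "jet2 f a b" "jet2 g c d"
  shows "jet2 (\<lambda>t. f t + g t) (a + c) (b + d)"
proof -
  from assms obtain f' g' where
    *: "\<forall>\<^sub>F t in nhds 0. (f has_real_derivative f' t) (at t)" "f' 0 = a"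
    "(f' has_real_derivative b) (at 0)"
    "\<forall>\<^sub>F t in nhds 0. (g has_real_derivative g' t) (at t)" "g' 0 = c"
    "(g' has_real_derivative d) (at 0)"
    unfolding jet2_def by blast
  show ?thesis
  proof (rule jet2I)
    show "\<forall>\<^sub>F t in nhds 0. ((\<lambda>t. f t + g t) has_real_derivative f' t + g' t) (at t)"
      using *(1,4) by eventually_elim (rule DERIV_add)
  qed (use * in \<open>auto intro: DERIV_add\<close>)
qed

lemma jet2_cmult:
  assumes "jet2 f a b"
  shows "jet2 (\<lambda>t. c * f t) (c * a) (c * b)"
proof -
  from assms obtain f' where
    *: "\<forall>\<^sub>F t in nhds 0. (f has_real_derivative f' t) (at t)" "f' 0 = a"
    "(f' has_real_derivative b) (at 0)"
    unfolding jet2_def by blast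
  show ?thesis
  proof (rule jet2I)
    show "\<forall>\<^sub>F t in nhds 0. ((\<lambda>t. c * f t) has_real_derivative c * f' t) (at t)"
      using *(1) by eventually_elim (rule DERIV_cmult)
  qed (use * in \<open>auto intro: DERIV_cmult\<close>)
qed

lemma jet2_diff:
  assumes "jet2 f a b" "jet2 g c d"
  shows "jet2 (\<lambda>t. f t - g t) (a - c) (b - d)"
  using jet2_add[OF assms(1) jet2_cmult[OF assms(2), of "-1"]] by simp

lemma jet2_power2:
  assumes "jet2 f a b"
  shows "jet2 (\<lambda>t. (f t)\<^sup>2) (2 * f 0 * a) (2 * a\<^sup>2 + 2 * f 0 * b)"
proof -
  from assms obtain f' where
    *: "\<forall>\<^sub>F t in nhds 0. (f has_real_derivative f' t) (at t)" "f' 0 = a"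
    "(f' has_real_derivative b) (at 0)"
    unfolding jet2_def by blast
  have f0: "(f has_real_derivative a) (at 0)"
    using eventually_nhds_x_imp_x[OF *(1)] *(2) by simp
  show ?thesis
  proof (rule jet2I)
    show "\<forall>\<^sub>F t in nhds 0. ((\<lambda>t. (f t)\<^sup>2) has_real_derivative 2 * f t * f' t) (at t)"
      using *(1) by eventually_elim (auto intro!: derivative_eq_intros)
    show "((\<lambda>t. 2 * f t * f' t) has_real_derivative 2 * a\<^sup>2 + 2 * f 0 * b) (at 0)"
      by (rule derivative_eq_intros f0 * refl)+ (simp add: *(2) power2_eq_square)
  qed (use * in auto)
qed

lemma jet2_ln:
  assumes "jet2 f a b" and pos: "f 0 > 0"
  shows "jet2 (\<lambda>t. ln (f t)) (a / f 0) (b / f 0 - (a / f 0)\<^sup>2)"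
proof -
  from assms obtain f' where
    *: "\<forall>\<^sub>F t in nhds 0. (f has_real_derivative f' t) (at t)" "f' 0 = a"
    "(f' has_real_derivative b) (at 0)"
    unfolding jet2_def by blast
  have f0: "(f has_real_derivative a) (at 0)"
    using eventually_nhds_x_imp_x[OF *(1)] *(2) by simp
  have "(f \<longlongrightarrow> f 0) (nhds 0)"
    using DERIV_isCont[OF f0] by (simp add: tendsto_at_iff_tendsto_nhds isCont_def)
  then have ev: "\<forall>\<^sub>F t in nhds 0. f t > 0"
    using pos order_tendstoD(1) by blast
  show ?thesis
  proof (rule jet2I)
    show "\<forall>\<^sub>F t in nhds 0. ((\<lambda>t. ln (f t)) has_real_derivative f' t / f t) (at t)"
      using *(1) ev by eventually_elim (auto intro!: derivative_eq_intros)
    show "((\<lambda>t. f' t / f t) has_real_derivative b / f 0 - (a / f 0)\<^sup>2) (at 0)"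
      by (rule derivative_eq_intros f0 * refl)+
        (use pos in \<open>simp_all add: *(2) power2_eq_square field_simps\<close>)
  qed (use * in auto)
qed

lemma jet2_local_max_nonpos:
  assumes "jet2 f a b" and max: "\<forall>\<^sub>F t in nhds 0. f t \<le> f 0"
  shows "b \<le> 0"
proof (rule ccontr)
  assume "\<not> b \<le> 0"
  from assms obtain f' where
    *: "\<forall>\<^sub>F t in nhds 0. (f has_real_derivative f' t) (at t)"
    "(f' has_real_derivative b) (at 0)"
    unfolding jet2_def by blast
  obtain e where e: "e > 0"
    "\<And>t. \<bar>t\<bar> < e \<Longrightarrow> (f has_real_derivative f' t) (at t) \<and> f t \<le> f 0"
    using eventually_conj[OF *(1) max] unfolding eventually_nhds_metric by auto
  have crit: "f' 0 = 0"
    by (rule DERIV_local_max[of f "f' 0" 0 e]) (use e in auto)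
  obtain d where d: "d > 0" "\<And>t. 0 < t \<Longrightarrow> t < d \<Longrightarrow> f' 0 < f' t"
    using DERIV_pos_inc_right[OF *(2)] \<open>\<not> b \<le> 0\<close> by auto
  define s where "s = min d e / 2"
  have s: "0 < s" "s < d" "s < e"
    using d(1) e(1) by (auto simp: s_def min_def)
  have "f 0 < f s"
  proof (rule DERIV_pos_imp_increasing_open[OF s(1)])
    show "\<exists>y. (f has_real_derivative y) (at x) \<and> 0 < y" if "0 < x" "x < s" for x
      using e(2)[of x] d(2)[of x] that s crit by (intro exI[of _ "f' x"]) auto
    show "continuous_on {0..s} f"
    proof (intro continuous_at_imp_continuous_on ballI)
      show "isCont f x" if "x \<in> {0..s}" for x
        using e(2)[of x] that s DERIV_isCont by auto
    qed
  qed
  then show False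
    using e(2)[of s] s by auto
qed

lemma jet2_Re_holomorphic_line:
  assumes hol: "h holomorphic_on S" "open S" "z \<in> S"
  shows "jet2 (\<lambda>t. Re (h (z + of_real t * v))) (Re (deriv h z * v)) (Re (deriv (deriv h) z * v\<^sup>2))"
proof -
  have "((\<lambda>t. z + of_real t * v) \<longlongrightarrow> z + of_real 0 * v) (nhds 0)"
    by (intro tendsto_intros filterlim_ident)
  then have ev: "\<forall>\<^sub>F t in nhds 0. z + of_real t * v \<in> S"
    using topological_tendstoD[OF _ hol(2)] hol(3) by auto
  have D: "((\<lambda>t. Re (f (z + of_real t * v))) has_real_derivative Re (f' * v)) (at t)"
    if "(f has_field_derivative f') (at (z + of_real t * v))" for f f' t
  proof -
    have "((\<lambda>t. z + of_real t * v) has_vector_derivative v) (at t)"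
      by (auto intro!: derivative_eq_intros)
    then have "((f \<circ> (\<lambda>t. z + of_real t * v)) has_vector_derivative v * f') (at t)"
      using that by (intro field_vector_diff_chain_at)
    then have "((\<lambda>t. Re (f (z + of_real t * v))) has_vector_derivative Re (v * f')) (at t)"
      using bounded_linear.has_vector_derivative[OF bounded_linear_Re] by (fastforce simp: o_def)
    then show ?thesis
      by (simp add: has_real_derivative_iff_has_vector_derivative mult.commute)
  qed
  show ?thesis
  proof (rule jet2I)
    show "\<forall>\<^sub>F t in nhds 0. ((\<lambda>t. Re (h (z + of_real t * v))) has_real_derivative
        Re (deriv h (z + of_real t * v) * v)) (at t)"
      using ev by eventually_elim (use hol holomorphic_derivI in \<open>blast intro: D\<close>)
    have "((\<lambda>x. deriv h x * v) has_field_derivative deriv (deriv h) z * v) (at z)"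
      using holomorphic_derivI[OF holomorphic_deriv[OF hol(1,2)] hol(2,3)]
      by (rule DERIV_cmult_right)
    then have "((\<lambda>x. deriv h x * v) has_field_derivative deriv (deriv h) z * v)
        (at (z + of_real (0::real) * v))"
      by simp
    from D[OF this]
    show "((\<lambda>t. Re (deriv h (z + of_real t * v) * v)) has_real_derivative
        Re (deriv (deriv h) z * v\<^sup>2)) (at 0)"
      by (simp only: power2_eq_square mult.assoc)
  qed auto
qed

lemma jet2_Im_holomorphic_line:
  assumes hol: "h holomorphic_on S" "open S" "z \<in> S"
  shows "jet2 (\<lambda>t. Im (h (z + of_real t * v))) (Im (deriv h z * v)) (Im (deriv (deriv h) z * v\<^sup>2))"
proof -
  have d: "deriv (\<lambda>w. - \<i> * h w) w = - \<i> * deriv h w" if "w \<in> S" for w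
    using that hol holomorphic_derivI
    by (intro DERIV_imp_deriv DERIV_cmult) blast
  have "(deriv h has_field_derivative deriv (deriv h) z) (at z)"
    using holomorphic_derivI[OF holomorphic_deriv[OF hol(1,2)] hol(2,3)] .
  then have "((\<lambda>w. - \<i> * deriv h w) has_field_derivative - \<i> * deriv (deriv h) z) (at z)"
    by (rule DERIV_cmult)
  then have "(deriv (\<lambda>w. - \<i> * h w) has_field_derivative - \<i> * deriv (deriv h) z) (at z)"
    by (rule has_field_derivative_transform_within_open[OF _ hol(2,3)]) (simp only: d)
  then have dd: "deriv (deriv (\<lambda>w. - \<i> * h w)) z = - \<i> * deriv (deriv h) z"
    by (rule DERIV_imp_deriv)
  have "(\<lambda>w. - \<i> * h w) holomorphic_on S"
    using hol(1) by (intro holomorphic_intros)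
  from jet2_Re_holomorphic_line[OF this hol(2,3), of v] show ?thesis
    unfolding dd d[OF hol(3)] by (simp add: algebra_simps)
qed

section \<open>Pointwise Laplacians of real functions in the plane\<close>

text \<open>
  Only the Laplacian at a single point matters for the maximum principle, and only through the
  two second derivatives along the axes.  The gradient is carried along, encoded as the complex
  number \<open>u\<^sub>x + \<i> u\<^sub>y\<close>, because the Laplacian of a logarithm depends on it.
\<close>

definition has_laplacian :: "(complex \<Rightarrow> real) \<Rightarrow> complex \<Rightarrow> real \<Rightarrow> complex \<Rightarrow> bool" where
  "has_laplacian u p d z \<longleftrightarrow> (\<exists>d1 d2. jet2 (\<lambda>t. u (z + of_real t * 1)) (Re p) d1 \<and>
      jet2 (\<lambda>t. u (z + of_real t * \<i>)) (Im p) d2 \<and> d = d1 + d2)"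

lemma has_laplacianI:
  assumes "jet2 (\<lambda>t. u (z + of_real t * 1)) (Re p) d1"
    and "jet2 (\<lambda>t. u (z + of_real t * \<i>)) (Im p) d2" and "d = d1 + d2"
  shows "has_laplacian u p d z"
  using assms unfolding has_laplacian_def by blast

lemma has_laplacianE:
  assumes "has_laplacian u p d z"
  obtains d1 d2 where "jet2 (\<lambda>t. u (z + of_real t * 1)) (Re p) d1"
    and "jet2 (\<lambda>t. u (z + of_real t * \<i>)) (Im p) d2" and "d = d1 + d2"
  using assms unfolding has_laplacian_def by blast

lemma has_laplacian_add:
  assumes "has_laplacian u p d z" "has_laplacian w q e z"
  shows "has_laplacian (\<lambda>x. u x + w x) (p + q) (d + e) z"
proof -
  from assms(1) obtain d1 d2 where u: "jet2 (\<lambda>t. u (z + of_real t * 1)) (Re p) d1"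
    "jet2 (\<lambda>t. u (z + of_real t * \<i>)) (Im p) d2" "d = d1 + d2"
    by (rule has_laplacianE)
  from assms(2) obtain e1 e2 where w: "jet2 (\<lambda>t. w (z + of_real t * 1)) (Re q) e1"
    "jet2 (\<lambda>t. w (z + of_real t * \<i>)) (Im q) e2" "e = e1 + e2"
    by (rule has_laplacianE)
  show ?thesis
    using jet2_add[OF u(1) w(1)] jet2_add[OF u(2) w(2)] u(3) w(3)
    by (intro has_laplacianI[where ?d1.0 = "d1 + e1" and ?d2.0 = "d2 + e2"]) auto
qed

lemma has_laplacian_cmult:
  assumes "has_laplacian u p d z"
  shows "has_laplacian (\<lambda>x. c * u x) (of_real c * p) (c * d) z"
proof -
  from assms(1) obtain d1 d2 where u: "jet2 (\<lambda>t. u (z + of_real t * 1)) (Re p) d1"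
    "jet2 (\<lambda>t. u (z + of_real t * \<i>)) (Im p) d2" "d = d1 + d2"
    by (rule has_laplacianE)
  show ?thesis
    using jet2_cmult[OF u(1), of c] jet2_cmult[OF u(2), of c] u(3)
    by (intro has_laplacianI[where ?d1.0 = "c * d1" and ?d2.0 = "c * d2"])
      (auto simp: algebra_simps)
qed

lemma has_laplacian_const_minus:
  assumes "has_laplacian u p d z"
  shows "has_laplacian (\<lambda>x. c - u x) (- p) (- d) z"
proof -
  have "has_laplacian (\<lambda>x. c) 0 0 z"
    by (rule has_laplacianI[where ?d1.0 = 0 and ?d2.0 = 0]) (auto intro: jet2_const)
  from has_laplacian_add[OF this has_laplacian_cmult[OF assms, of "-1"]] show ?thesis
    by simp
qed

lemma has_laplacian_ln:
  assumes "has_laplacian u p d z" and "u z > 0"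
  shows "has_laplacian (\<lambda>x. ln (u x)) (p / of_real (u z)) (d / u z - (cmod p / u z)\<^sup>2) z"
proof -
  from assms(1) obtain d1 d2 where u: "jet2 (\<lambda>t. u (z + of_real t * 1)) (Re p) d1"
    "jet2 (\<lambda>t. u (z + of_real t * \<i>)) (Im p) d2" "d = d1 + d2"
    by (rule has_laplacianE)
  have "(cmod p / u z)\<^sup>2 = (Re p / u z)\<^sup>2 + (Im p / u z)\<^sup>2"
    by (simp add: power_divide cmod_power2 add_divide_distrib)
  then show ?thesis
    using jet2_ln[OF u(1)] jet2_ln[OF u(2)] assms(2) u(3)
    by (intro has_laplacianI[where ?d1.0 = "d1 / u z - (Re p / u z)\<^sup>2"
          and ?d2.0 = "d2 / u z - (Im p / u z)\<^sup>2"])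
      (auto simp: add_divide_distrib)
qed

lemma has_laplacian_local_max_nonpos:
  assumes "has_laplacian u p d z" and max: "\<forall>\<^sub>F x in nhds z. u x \<le> u z"
  shows "d \<le> 0"
proof -
  from assms(1) obtain d1 d2 where u: "jet2 (\<lambda>t. u (z + of_real t * 1)) (Re p) d1"
    "jet2 (\<lambda>t. u (z + of_real t * \<i>)) (Im p) d2" "d = d1 + d2"
    by (rule has_laplacianE)
  have ev: "\<forall>\<^sub>F t in nhds (0::real). u (z + of_real t * v) \<le> u (z + of_real 0 * v)" for v
  proof -
    have "((\<lambda>t::real. z + of_real t * v) \<longlongrightarrow> z + of_real 0 * v) (nhds 0)"
      by (intro tendsto_intros filterlim_ident)
    then have "filterlim (\<lambda>t::real. z + of_real t * v) (nhds z) (nhds 0)"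
      by simp
    from eventually_compose_filterlim[OF max this] show ?thesis
      by simp
  qed
  show ?thesis
    using jet2_local_max_nonpos[OF u(1) ev] jet2_local_max_nonpos[OF u(2) ev] u(3) by linarith
qed

text \<open>
  In Wirtinger terms, \<open>\<bar>F\<bar>\<^sup>2\<close> has \<open>z\<close>-derivative \<open>F\<^sub>z cnj F + F cnj (F\<^sub>z\<^sub>b)\<close> where \<open>F\<^sub>z = h'\<close> and
  \<open>F\<^sub>z\<^sub>b = cnj g'\<close>; the gradient is twice the conjugate of it.  The second derivatives of \<open>h\<close>
  and \<open>g\<close> cancel between the two axes because \<open>1\<^sup>2 + \<i>\<^sup>2 = 0\<close>.
\<close>

lemma has_laplacian_cmod2_harmonic:
  assumes h: "h holomorphic_on S" and g: "g holomorphic_on S" and S: "open S" "z \<in> S"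
    and F: "F = (\<lambda>x. h x + cnj (g x))"
  shows "has_laplacian (\<lambda>x. (cmod (F x))\<^sup>2)
    (2 * cnj (deriv h z * cnj (F z) + deriv g z * F z))
    (4 * ((cmod (deriv h z))\<^sup>2 + (cmod (deriv g z))\<^sup>2)) z"
proof -
  define h2 where "h2 = deriv (deriv h) z"
  define g2 where "g2 = deriv (deriv g) z"
  define X where "X v = Re (deriv h z * v) + Re (deriv g z * v)" for v
  define Y where "Y v = Im (deriv h z * v) - Im (deriv g z * v)" for v
  define X2 where "X2 v = Re (h2 * v\<^sup>2) + Re (g2 * v\<^sup>2)" for v
  define Y2 where "Y2 v = Im (h2 * v\<^sup>2) - Im (g2 * v\<^sup>2)" for v
  have jet: "jet2 (\<lambda>t. (cmod (F (z + of_real t * v)))\<^sup>2)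
      (2 * Re (F z) * X v + 2 * Im (F z) * Y v)
      (2 * (X v)\<^sup>2 + 2 * Re (F z) * X2 v + (2 * (Y v)\<^sup>2 + 2 * Im (F z) * Y2 v))" for v
  proof -
    have "jet2 (\<lambda>t. Re (F (z + of_real t * v))) (X v) (X2 v)"
      using jet2_add[OF jet2_Re_holomorphic_line[OF h S] jet2_Re_holomorphic_line[OF g S]]
      by (simp add: F X_def X2_def h2_def g2_def)
    moreover have "jet2 (\<lambda>t. Im (F (z + of_real t * v))) (Y v) (Y2 v)"
      using jet2_diff[OF jet2_Im_holomorphic_line[OF h S] jet2_Im_holomorphic_line[OF g S]]
      by (simp add: F Y_def Y2_def h2_def g2_def)
    ultimately show ?thesis
      using jet2_add[OF jet2_power2 jet2_power2] by (fastforce simp: cmod_power2)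
  qed
  show ?thesis
  proof (rule has_laplacianI)
    show "jet2 (\<lambda>t. (cmod (F (z + of_real t * 1)))\<^sup>2)
        (Re (2 * cnj (deriv h z * cnj (F z) + deriv g z * F z)))
        (2 * (X 1)\<^sup>2 + 2 * Re (F z) * X2 1 + (2 * (Y 1)\<^sup>2 + 2 * Im (F z) * Y2 1))"
      using jet[of 1] by (simp add: X_def Y_def algebra_simps)
    show "jet2 (\<lambda>t. (cmod (F (z + of_real t * \<i>)))\<^sup>2)
        (Im (2 * cnj (deriv h z * cnj (F z) + deriv g z * F z)))
        (2 * (X \<i>)\<^sup>2 + 2 * Re (F z) * X2 \<i> + (2 * (Y \<i>)\<^sup>2 + 2 * Im (F z) * Y2 \<i>))"
      using jet[of \<i>] by (simp add: X_def Y_def algebra_simps)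
    have "X2 \<i> = - X2 1" "Y2 \<i> = - Y2 1"
      by (simp_all add: X2_def Y2_def)
    moreover have "(X 1)\<^sup>2 + (Y 1)\<^sup>2 + ((X \<i>)\<^sup>2 + (Y \<i>)\<^sup>2)
        = 2 * ((cmod (deriv h z))\<^sup>2 + (cmod (deriv g z))\<^sup>2)"
      unfolding cmod_power2 by (simp add: X_def Y_def power2_eq_square algebra_simps)
    ultimately show "4 * ((cmod (deriv h z))\<^sup>2 + (cmod (deriv g z))\<^sup>2) =
        2 * (X 1)\<^sup>2 + 2 * Re (F z) * X2 1 + (2 * (Y 1)\<^sup>2 + 2 * Im (F z) * Y2 1) +
        (2 * (X \<i>)\<^sup>2 + 2 * Re (F z) * X2 \<i> + (2 * (Y \<i>)\<^sup>2 + 2 * Im (F z) * Y2 \<i>))"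
      by simp
  qed
qed

section \<open>The Schwarz--Pick bound on a disc\<close>

text \<open>
  The curvature inequality at a maximum \<open>z\<close> of the quotient of the two densities; the logarithm
  is taken of the squared quotient so that only squared moduli occur.
\<close>

lemma density_bound_at_local_max:
  assumes h: "h holomorphic_on S" and g: "g holomorphic_on S" and S: "open S" "z \<in> S"
    and F: "F = (\<lambda>x. h x + cnj (g x))"
    and k: "k < 1" "cmod (deriv g z) \<le> k * cmod (deriv h z)"
    and Fz: "cmod (F z) < 1" and z: "cmod z < \<rho>"
    and nz: "deriv h z \<noteq> 0"
    and max: "\<forall>\<^sub>F x in nhds z. cmod (deriv h x) * (\<rho>\<^sup>2 - (cmod x)\<^sup>2) / (1 - (cmod (F x))\<^sup>2)
        \<le> cmod (deriv h z) * (\<rho>\<^sup>2 - (cmod z)\<^sup>2) / (1 - (cmod (F z))\<^sup>2)"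
  shows "(1 - k) * cmod (deriv h z) * (\<rho>\<^sup>2 - (cmod z)\<^sup>2) \<le> \<rho> * (1 - (cmod (F z))\<^sup>2)"
proof -
  define N where "N x = (cmod (deriv h x))\<^sup>2" for x
  define q where "q x = \<rho>\<^sup>2 - (cmod x)\<^sup>2" for x
  define u where "u x = 1 - (cmod (F x))\<^sup>2" for x
  define P where "P = cmod (deriv h z)"
  define Q where "Q = cmod (deriv g z)"
  define T where "T = deriv h z * cnj (F z) + deriv g z * F z"
  have \<rho>: "0 < \<rho>"
    using z norm_ge_zero[of z] by linarith
  have "(cmod z)\<^sup>2 < \<rho>\<^sup>2"
    using z by (intro power_strict_mono) auto
  then have pos: "N z > 0" "q z > 0" "u z > 0"
    using nz Fz by (auto simp: N_def q_def u_def power_less_one_iff)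
  have h1: "deriv h holomorphic_on S"
    using h S by (intro holomorphic_deriv)
  have zero: "(\<lambda>x. 0) holomorphic_on S" and ident: "(\<lambda>x. x) holomorphic_on S"
    by (auto intro: holomorphic_intros)
  \<comment> \<open>The three Laplacians are instances of one formula, with holomorphic parts \<open>h'\<close>, the
      identity and \<open>h\<close>.\<close>
  have "has_laplacian N (2 * cnj (deriv (deriv h) z * cnj (deriv h z)))
      (4 * (cmod (deriv (deriv h) z))\<^sup>2) z"
    using has_laplacian_cmod2_harmonic[OF h1 zero S refl] by (simp add: N_def[abs_def])
  from has_laplacian_ln[OF this pos(1)]
  have N: "\<exists>p. has_laplacian (\<lambda>x. ln (N x)) p 0 z"
    using nz by (auto simp: N_def norm_mult power_divide power_mult_distrib field_simps
        power2_eq_square)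
  have "has_laplacian q (- (2 * z)) (- 4) z"
    using has_laplacian_const_minus[OF has_laplacian_cmod2_harmonic[OF ident zero S refl]]
    by (simp add: q_def[abs_def])
  from has_laplacian_ln[OF this pos(2)]
  have q: "\<exists>p. has_laplacian (\<lambda>x. ln (q x)) p (- (4 * \<rho>\<^sup>2 / (q z)\<^sup>2)) z"
  proof -
    have "- 4 / q z - (cmod (- (2 * z)) / q z)\<^sup>2 = - (4 * (q z + (cmod z)\<^sup>2) / (q z)\<^sup>2)"
      using pos by (simp add: norm_mult field_simps power2_eq_square)
    then show ?thesis
      using \<open>has_laplacian (\<lambda>x. ln (q x)) _ _ z\<close> by (auto simp: q_def)
  qed
  have "has_laplacian u (- (2 * cnj T)) (- (4 * (P\<^sup>2 + Q\<^sup>2))) z"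
    using has_laplacian_const_minus[OF has_laplacian_cmod2_harmonic[OF h g S F]]
    by (simp add: u_def[abs_def] T_def P_def Q_def)
  from has_laplacian_ln[OF this pos(3)]
  have u: "\<exists>p. has_laplacian (\<lambda>x. ln (u x)) p (- (4 * (u z * (P\<^sup>2 + Q\<^sup>2) + (cmod T)\<^sup>2) / (u z)\<^sup>2)) z"
  proof -
    have "- (4 * (P\<^sup>2 + Q\<^sup>2)) / u z - (cmod (- (2 * cnj T)) / u z)\<^sup>2
        = - (4 * (u z * (P\<^sup>2 + Q\<^sup>2) + (cmod T)\<^sup>2) / (u z)\<^sup>2)"
      using pos by (simp add: norm_mult field_simps power2_eq_square)
    then show ?thesis
      using \<open>has_laplacian (\<lambda>x. ln (u x)) _ _ z\<close> by auto
  qed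
  obtain p where "has_laplacian (\<lambda>x. ln (N x) + (2 * ln (q x) + - 2 * ln (u x))) p
      (0 + (2 * - (4 * \<rho>\<^sup>2 / (q z)\<^sup>2)
        + - 2 * - (4 * (u z * (P\<^sup>2 + Q\<^sup>2) + (cmod T)\<^sup>2) / (u z)\<^sup>2))) z"
    using N q u has_laplacian_add has_laplacian_cmult by meson
  moreover have "\<forall>\<^sub>F x in nhds z. ln (N x) + (2 * ln (q x) + - 2 * ln (u x))
      \<le> ln (N z) + (2 * ln (q z) + - 2 * ln (u z))"
  proof -
    have lim: "(N \<longlongrightarrow> N z) (nhds z)" "(q \<longlongrightarrow> q z) (nhds z)" "(u \<longlongrightarrow> u z) (nhds z)"
    proof -
      have c: "isCont (deriv h) z" "isCont h z" "isCont g z"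
        using h1 h g S by (auto simp: continuous_on_eq_continuous_at
            dest!: holomorphic_on_imp_continuous_on)
      have "isCont N z" "isCont q z" "isCont u z"
        using c unfolding N_def[abs_def] q_def[abs_def] u_def[abs_def] F
        by (auto intro!: continuous_intros)
      then show "(N \<longlongrightarrow> N z) (nhds z)" "(q \<longlongrightarrow> q z) (nhds z)" "(u \<longlongrightarrow> u z) (nhds z)"
        by (auto simp: tendsto_at_iff_tendsto_nhds isCont_def)
    qed
    have ev: "\<forall>\<^sub>F x in nhds z. N x > 0" "\<forall>\<^sub>F x in nhds z. q x > 0" "\<forall>\<^sub>F x in nhds z. u x > 0"
      using lim pos order_tendstoD(1) by blast+
    have expand: "ln (N x) + (2 * ln (q x) + - 2 * ln (u x))
        = 2 * ln (cmod (deriv h x) * q x / u x)" if "N x > 0" "q x > 0" "u x > 0" for x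
      using that by (auto simp: N_def ln_mult ln_div ln_realpow)
    show ?thesis
      using max ev
    proof eventually_elim
      case (elim x)
      have "0 < cmod (deriv h x) * q x / u x"
        using elim by (auto simp: N_def)
      moreover have "cmod (deriv h x) * q x / u x \<le> cmod (deriv h z) * q z / u z"
        using elim by (simp add: q_def u_def)
      ultimately show ?case
        using elim pos by (simp only: expand) (simp add: ln_mono)
    qed
  qed
  ultimately have "0 + (2 * - (4 * \<rho>\<^sup>2 / (q z)\<^sup>2)
      + - 2 * - (4 * (u z * (P\<^sup>2 + Q\<^sup>2) + (cmod T)\<^sup>2) / (u z)\<^sup>2)) \<le> 0"
    by (rule has_laplacian_local_max_nonpos)
  then have "(u z * (P\<^sup>2 + Q\<^sup>2) + (cmod T)\<^sup>2) / (u z)\<^sup>2 \<le> \<rho>\<^sup>2 / (q z)\<^sup>2"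
    by (simp only: times_divide_eq_right[symmetric])
  \<comment> \<open>Both summands of the numerator dominate a multiple of \<open>(P - Q)\<^sup>2\<close>, and the two
      coefficients \<open>1 - \<bar>F\<bar>\<^sup>2\<close> and \<open>\<bar>F\<bar>\<^sup>2\<close> add up to one.\<close>
  moreover have "((1 - k) * P)\<^sup>2 \<le> u z * (P\<^sup>2 + Q\<^sup>2) + (cmod T)\<^sup>2"
  proof -
    have PQ0: "0 \<le> P" "0 \<le> Q"
      by (simp_all add: P_def Q_def)
    have PQ: "(1 - k) * P \<le> P - Q" "0 \<le> (1 - k) * P"
      using k PQ0 by (simp add: P_def Q_def left_diff_distrib, intro mult_nonneg_nonneg) auto
    have "cmod (F z) * (P - Q) \<le> cmod T"
      using norm_diff_ineq[of "deriv h z * cnj (F z)" "deriv g z * F z"]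
      by (simp add: T_def P_def Q_def norm_mult algebra_simps)
    then have "(cmod (F z) * (P - Q))\<^sup>2 \<le> (cmod T)\<^sup>2"
      using PQ PQ0 by (intro power_mono) auto
    moreover have "u z * (P - Q)\<^sup>2 \<le> u z * (P\<^sup>2 + Q\<^sup>2)"
      using pos PQ0 by (intro mult_left_mono) (auto simp: power2_diff)
    moreover have "u z * (P - Q)\<^sup>2 + (cmod (F z) * (P - Q))\<^sup>2 = (P - Q)\<^sup>2"
      by (simp add: u_def left_diff_distrib power_mult_distrib)
    moreover have "((1 - k) * P)\<^sup>2 \<le> (P - Q)\<^sup>2"
      using PQ by (intro power_mono) auto
    ultimately show ?thesis
      by linarith
  qed
  ultimately have "((1 - k) * P)\<^sup>2 / (u z)\<^sup>2 \<le> \<rho>\<^sup>2 / (q z)\<^sup>2"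
    by (meson divide_right_mono order_trans zero_le_power2)
  then have "((1 - k) * P)\<^sup>2 * (q z)\<^sup>2 \<le> \<rho>\<^sup>2 * (u z)\<^sup>2"
    using pos by (simp add: pos_divide_le_eq pos_le_divide_eq)
  then have "((1 - k) * P * q z)\<^sup>2 \<le> (\<rho> * u z)\<^sup>2"
    by (simp only: power_mult_distrib)
  moreover have "0 \<le> \<rho> * u z"
    using \<rho> pos by simp
  ultimately have "(1 - k) * P * q z \<le> \<rho> * u z"
    by (rule power2_le_imp_le)
  then show ?thesis
    unfolding P_def q_def u_def .
qed

lemma schwarz_pick_subdisc:
  assumes h: "h holomorphic_on ball 0 r" and g: "g holomorphic_on ball 0 r"
    and F: "F = (\<lambda>x. h x + cnj (g x))"
    and k: "k < 1" "\<And>x. x \<in> ball 0 r \<Longrightarrow> cmod (deriv g x) \<le> k * cmod (deriv h x)"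
    and F1: "\<And>x. x \<in> ball 0 r \<Longrightarrow> cmod (F x) < 1"
    and w: "cmod w < \<rho>" "\<rho> < r"
  shows "(1 - k) * cmod (deriv h w) * (\<rho>\<^sup>2 - (cmod w)\<^sup>2) \<le> \<rho> * (1 - (cmod (F w))\<^sup>2)"
proof -
  define \<phi> where
    "\<phi> x = cmod (deriv h x) * (\<rho>\<^sup>2 - (cmod x)\<^sup>2) / (1 - (cmod (F x))\<^sup>2)" for x
  have \<rho>: "0 < \<rho>"
    using w norm_ge_zero[of w] by linarith
  have sub: "cball 0 \<rho> \<subseteq> ball (0::complex) r"
    using w by auto
  have u: "1 - (cmod (F x))\<^sup>2 > 0" if "x \<in> ball 0 r" for x
    using F1[OF that] by (simp add: power_less_one_iff)
  have "deriv h holomorphic_on ball 0 r"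
    using h by (intro holomorphic_deriv) auto
  then have c: "continuous_on (cball 0 \<rho>) (deriv h)" "continuous_on (cball 0 \<rho>) h"
    "continuous_on (cball 0 \<rho>) g"
    using h g sub holomorphic_on_imp_continuous_on continuous_on_subset by blast+
  have "1 - (cmod (h x + cnj (g x)))\<^sup>2 \<noteq> 0" if "x \<in> cball 0 \<rho>" for x
    using u[of x] sub that unfolding F by auto
  then have "continuous_on (cball 0 \<rho>) \<phi>"
    unfolding \<phi>_def F using c by (intro continuous_intros) auto
  then obtain m where m: "m \<in> cball 0 \<rho>" "\<And>x. x \<in> cball 0 \<rho> \<Longrightarrow> \<phi> x \<le> \<phi> m"
    using continuous_attains_sup[of "cball (0::complex) \<rho>" \<phi>] \<rho> by auto
  have "(1 - k) * \<phi> m \<le> \<rho>"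
  proof (cases "cmod m = \<rho> \<or> deriv h m = 0")
    case True
    then show ?thesis
      using \<rho> by (auto simp: \<phi>_def)
  next
    case False
    then have m\<rho>: "cmod m < \<rho>"
      using m(1) by auto
    then have mr: "m \<in> ball 0 r"
      using w by auto
    have "\<forall>\<^sub>F x in nhds m. x \<in> ball 0 \<rho>"
      using m\<rho> by (intro eventually_nhds_in_open) auto
    then have max: "\<forall>\<^sub>F x in nhds m. \<phi> x \<le> \<phi> m"
      by eventually_elim (use m(2) in auto)
    have "(1 - k) * cmod (deriv h m) * (\<rho>\<^sup>2 - (cmod m)\<^sup>2) \<le> \<rho> * (1 - (cmod (F m))\<^sup>2)"
      using density_bound_at_local_max[OF h g open_ball mr F k(1) k(2)[OF mr] F1[OF mr] m\<rho>] False
        max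
      by (auto simp: \<phi>_def)
    then show ?thesis
      using u[OF mr] by (simp add: \<phi>_def field_simps)
  qed
  moreover have "(1 - k) * \<phi> w \<le> (1 - k) * \<phi> m"
    using m(2)[of w] w k by (intro mult_left_mono) auto
  ultimately have "(1 - k) * \<phi> w \<le> \<rho>"
    by linarith
  moreover have "w \<in> ball 0 r"
    using w by auto
  ultimately show ?thesis
    using u[of w] by (simp add: \<phi>_def field_simps)
qed

lemma schwarz_pick_disc:
  assumes h: "h holomorphic_on ball 0 r" and g: "g holomorphic_on ball 0 r"
    and F: "F = (\<lambda>x. h x + cnj (g x))"
    and k: "k < 1" "\<And>x. x \<in> ball 0 r \<Longrightarrow> cmod (deriv g x) \<le> k * cmod (deriv h x)"
    and F1: "\<And>x. x \<in> ball 0 r \<Longrightarrow> cmod (F x) < 1"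
    and w: "cmod w < r"
  shows "(1 - k) * cmod (deriv h w) * (r\<^sup>2 - (cmod w)\<^sup>2) \<le> r * (1 - (cmod (F w))\<^sup>2)"
proof (rule tendsto_le)
  show "((\<lambda>\<rho>. (1 - k) * cmod (deriv h w) * (\<rho>\<^sup>2 - (cmod w)\<^sup>2))
      \<longlongrightarrow> (1 - k) * cmod (deriv h w) * (r\<^sup>2 - (cmod w)\<^sup>2)) (at_left r)"
    by (intro tendsto_intros)
  show "((\<lambda>\<rho>. \<rho> * (1 - (cmod (F w))\<^sup>2)) \<longlongrightarrow> r * (1 - (cmod (F w))\<^sup>2)) (at_left r)"
    by (intro tendsto_intros)
  have "\<forall>\<^sub>F \<rho> in at_left r. \<rho> \<in> {cmod w<..<r}"
    by (rule eventually_at_leftI[OF _ w])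
  then show "\<forall>\<^sub>F \<rho> in at_left r. (1 - k) * cmod (deriv h w) * (\<rho>\<^sup>2 - (cmod w)\<^sup>2)
      \<le> \<rho> * (1 - (cmod (F w))\<^sup>2)"
  proof eventually_elim
    case (elim \<rho>)
    then show ?case
      using schwarz_pick_subdisc[OF h g F k F1, of w \<rho>] by simp
  qed
qed auto

section \<open>Restriction to complex lines\<close>

lemma has_field_derivative_restrict_line:
  fixes a \<theta> :: "complex ^ 'n"
  assumes "(h has_derivative (\<lambda>v. \<Sum>j\<in>UNIV. c $ j * v $ j)) (at (a + \<zeta> *s \<theta>))"
  shows "((\<lambda>\<zeta>. h (a + \<zeta> *s \<theta>)) has_field_derivative (\<Sum>j\<in>UNIV. c $ j * \<theta> $ j)) (at \<zeta>)"
proof -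
  have bl: "bounded_linear (\<lambda>x. x *s \<theta>)"
    by (intro linear_conv_bounded_linear[THEN iffD1] linearI)
      (auto simp: vec_eq_iff algebra_simps)
  have "((\<lambda>x. a + x *s \<theta>) has_derivative (\<lambda>x. 0 + x *s \<theta>)) (at \<zeta>)"
    by (intro has_derivative_add has_derivative_const bounded_linear_imp_has_derivative bl)
  from has_derivative_compose[OF this assms]
  show ?thesis
    unfolding has_field_derivative_def
    by (rule has_derivative_eq_rhs) (auto simp: sum_distrib_left mult_ac)
qed

lemma holomorphic_on_restrict_line:
  assumes "holomorphic_vec_on h G" and S: "open S" "\<And>\<zeta>. \<zeta> \<in> S \<Longrightarrow> a + \<zeta> *s \<theta> \<in> G"
  shows "(\<lambda>\<zeta>. h (a + \<zeta> *s \<theta>)) holomorphic_on S"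
  unfolding holomorphic_on_open[OF S(1)]
proof
  fix \<zeta> assume "\<zeta> \<in> S"
  then obtain c where "(h has_derivative (\<lambda>v. \<Sum>j\<in>UNIV. c $ j * v $ j)) (at (a + \<zeta> *s \<theta>))"
    using assms unfolding holomorphic_vec_on_def by blast
  from has_field_derivative_restrict_line[OF this]
  show "\<exists>f'. ((\<lambda>\<zeta>. h (a + \<zeta> *s \<theta>)) has_field_derivative f') (at \<zeta>)"
    by blast
qed

text \<open>
  The Wirtinger gradients separate the two holomorphic parts; as \<open>grad\<close> and \<open>grad_bar\<close> are
  defined by derivatives in real directions, this is read off from the real derivative
  \<open>v \<mapsto> c v + cnj (d v)\<close> in the directions of the coordinate axes.
\<close>

lemma grad_of_holomorphic_parts:
  fixes f :: "complex ^ 'n \<Rightarrow> complex"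
  assumes f: "\<And>x. x \<in> G \<Longrightarrow> f x = h x + cnj (g x)" and G: "open G" "z \<in> G"
    and h: "(h has_derivative (\<lambda>v. \<Sum>j\<in>UNIV. c $ j * v $ j)) (at z)"
    and g: "(g has_derivative (\<lambda>v. \<Sum>j\<in>UNIV. d $ j * v $ j)) (at z)"
  shows "grad f z = c" and "grad_bar f z = cnj_vec d"
proof -
  have "((\<lambda>x. h x + cnj (g x)) has_derivative
      (\<lambda>v. (\<Sum>j\<in>UNIV. c $ j * v $ j) + cnj (\<Sum>j\<in>UNIV. d $ j * v $ j))) (at z)"
    by (intro has_derivative_add h has_derivative_cnj g)
  then have Df: "(f has_derivative
      (\<lambda>v. (\<Sum>j\<in>UNIV. c $ j * v $ j) + cnj (\<Sum>j\<in>UNIV. d $ j * v $ j))) (at z)"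
    by (rule has_derivative_transform_within_open[OF _ G]) (simp add: f)
  have dd: "ddir v f z = (\<Sum>j\<in>UNIV. c $ j * v $ j) + cnj (\<Sum>j\<in>UNIV. d $ j * v $ j)" for v
  proof -
    have "((\<lambda>t::real. z + t *\<^sub>R v) has_derivative (\<lambda>t. t *\<^sub>R v)) (at 0)"
      by (auto intro!: derivative_eq_intros)
    moreover have "(f has_derivative
      (\<lambda>v. (\<Sum>j\<in>UNIV. c $ j * v $ j) + cnj (\<Sum>j\<in>UNIV. d $ j * v $ j))) (at (z + (0::real) *\<^sub>R v))"
      using Df by simp
    ultimately have "((\<lambda>t::real. f (z + t *\<^sub>R v)) has_derivative
        (\<lambda>t. (\<Sum>j\<in>UNIV. c $ j * (t *\<^sub>R v) $ j) + cnj (\<Sum>j\<in>UNIV. d $ j * (t *\<^sub>R v) $ j))) (at 0)"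
      by (rule has_derivative_compose)
    then have "((\<lambda>t::real. f (z + t *\<^sub>R v)) has_vector_derivative
        (\<Sum>j\<in>UNIV. c $ j * v $ j) + cnj (\<Sum>j\<in>UNIV. d $ j * v $ j)) (at 0)"
      unfolding has_vector_derivative_def
      by (rule has_derivative_eq_rhs) (auto simp: scaleR_sum_right algebra_simps)
    then show ?thesis
      unfolding ddir_def by (rule vector_derivative_at)
  qed
  have ax: "(\<Sum>i\<in>UNIV. b $ i * (axis j x :: complex ^ 'n) $ i) = b $ j * x"
    for b :: "complex ^ 'n" and j x
  proof -
    have "(\<Sum>i\<in>UNIV. b $ i * (axis j x :: complex ^ 'n) $ i)
        = (\<Sum>i\<in>UNIV. if i = j then b $ j * x else 0)"
      by (rule sum.cong) (auto simp: axis_def)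
    then show ?thesis
      by simp
  qed
  show "grad f z = c" "grad_bar f z = cnj_vec d"
    by (simp_all add: grad_def grad_bar_def cnj_vec_def vec_eq_iff dd ax algebra_simps)
qed

lemma norm_power2_eq_hinner: "of_real ((norm x)\<^sup>2) = hinner x x"
  by (simp add: hinner_def norm_vec_def L2_set_def sum_nonneg complex_norm_square del: of_real_power)

lemma norm_power2_add_orthogonal:
  fixes a \<theta> :: "complex ^ 'n"
  assumes "hinner a \<theta> = 0" "norm \<theta> = 1"
  shows "(norm (a + \<zeta> *s \<theta>))\<^sup>2 = (norm a)\<^sup>2 + (cmod \<zeta>)\<^sup>2"
proof -
  have sym: "hinner \<theta> a = 0"
  proof -
    have "hinner \<theta> a = cnj (hinner a \<theta>)"
      by (simp add: hinner_def mult.commute)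
    then show ?thesis
      using assms by simp
  qed
  have unit: "hinner \<theta> \<theta> = 1"
    using norm_power2_eq_hinner[of \<theta>] assms by simp
  have "hinner (a + \<zeta> *s \<theta>) (a + \<zeta> *s \<theta>) =
      hinner a a + cnj \<zeta> * hinner a \<theta> + \<zeta> * hinner \<theta> a + \<zeta> * cnj \<zeta> * hinner \<theta> \<theta>"
    by (simp add: hinner_def algebra_simps sum.distrib sum_distrib_left)
  then have "complex_of_real ((norm (a + \<zeta> *s \<theta>))\<^sup>2) = of_real ((norm a)\<^sup>2 + (cmod \<zeta>)\<^sup>2)"
    unfolding norm_power2_eq_hinner of_real_add assms sym unit
    by (simp add: complex_norm_square del: of_real_power)
  then show ?thesis
    by (simp only: of_real_eq_iff)
qed

theorem theorem1:
  fixes k :: real and f :: "complex ^ 'n \<Rightarrow> complex" and \<theta> z :: "complex ^ 'n"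
  assumes "0 < k" and "k < 1"
    and "f \<in> pluriharmonic_class k (ball 0 1)"
    and "\<And>w. w \<in> ball 0 1 \<Longrightarrow> cmod (f w) < 1"
    and "\<theta> \<in> sphere 0 1" and "z \<in> ball 0 1"
  shows "cmod (hinner (grad_bar f z) \<theta>) + cmod (hinner (grad f z) (cnj_vec \<theta>))
           \<le> (1 + k) / (1 - k) * ((1 - (cmod (f z))\<^sup>2) / (1 - (norm z)\<^sup>2))"
proof -
  obtain h g where hg: "holomorphic_vec_on h (ball 0 1)" "holomorphic_vec_on g (ball 0 1)"
    and f: "\<And>x. x \<in> ball 0 1 \<Longrightarrow> f x = h x + cnj (g x)"
    using assms(3) unfolding pluriharmonic_class_def by blast
  have qr: "cmod (hinner (grad_bar f x) \<theta>) \<le> k * cmod (hinner (grad f x) (cnj_vec \<theta>))"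
    if "x \<in> ball 0 1" for x
    using assms(3,5) that unfolding pluriharmonic_class_def by blast
  \<comment> \<open>The foot \<open>a\<close> of the perpendicular from the origin to the line through \<open>z\<close>, and the
      parameter \<open>w\<close> of \<open>z\<close> on that line.\<close>
  define w where "w = hinner z \<theta>"
  define a where "a = z - w *s \<theta>"
  define r where "r = sqrt (1 - (norm a)\<^sup>2)"
  have \<theta>: "norm \<theta> = 1"
    using assms(5) by simp
  have "hinner a \<theta> = hinner z \<theta> - w * hinner \<theta> \<theta>"
    by (simp add: a_def hinner_def algebra_simps sum_subtractf sum_distrib_left)
  then have "hinner a \<theta> = 0"
    using norm_power2_eq_hinner[of \<theta>] \<theta> by (simp add: w_def)
  note pyth = norm_power2_add_orthogonal[OF this \<theta>]
  have z: "z = a + w *s \<theta>"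
    by (simp add: a_def)
  have z1: "(norm z)\<^sup>2 < 1"
    using assms(6) by (simp add: power_less_one_iff)
  have nz: "(norm z)\<^sup>2 = (norm a)\<^sup>2 + (cmod w)\<^sup>2"
    using pyth[of w] z by simp
  have r2: "r\<^sup>2 = 1 - (norm a)\<^sup>2"
    using z1 nz zero_le_power2[of "cmod w"] unfolding r_def
    by (intro real_sqrt_pow2) linarith
  have r: "0 \<le> r" "r \<le> 1" "cmod w < r"
  proof -
    show "r \<le> 1"
      by (simp add: r_def)
    show "0 \<le> r"
      using z1 nz zero_le_power2[of "cmod w"] unfolding r_def
      by (intro real_sqrt_ge_zero) linarith
    moreover have "(cmod w)\<^sup>2 < r\<^sup>2"
      using z1 nz r2 by linarith
    ultimately show "cmod w < r"
      using power2_less_imp_less by blast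
  qed
  have ball: "a + \<zeta> *s \<theta> \<in> ball 0 1" if "\<zeta> \<in> ball 0 r" for \<zeta>
  proof -
    have "(cmod \<zeta>)\<^sup>2 < r\<^sup>2"
      using that by (intro power_strict_mono) auto
    then have "(norm (a + \<zeta> *s \<theta>))\<^sup>2 < 1\<^sup>2"
      using pyth[of \<zeta>] r2 by simp
    then show ?thesis
      using power2_less_imp_less[of "norm (a + \<zeta> *s \<theta>)" 1] by simp
  qed
  define H where "H \<zeta> = h (a + \<zeta> *s \<theta>)" for \<zeta>
  define G where "G \<zeta> = g (a + \<zeta> *s \<theta>)" for \<zeta>
  have hol: "H holomorphic_on ball 0 r" "G holomorphic_on ball 0 r"
    unfolding H_def[abs_def] G_def[abs_def]
    using holomorphic_on_restrict_line[OF _ open_ball ball] hg by blast+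
  have derivs: "hinner (grad f (a + \<zeta> *s \<theta>)) (cnj_vec \<theta>) = deriv H \<zeta> \<and>
      hinner (grad_bar f (a + \<zeta> *s \<theta>)) \<theta> = cnj (deriv G \<zeta>)" if \<zeta>: "\<zeta> \<in> ball 0 r" for \<zeta>
  proof -
    obtain c d where
      c: "(h has_derivative (\<lambda>v. \<Sum>j\<in>UNIV. c $ j * v $ j)) (at (a + \<zeta> *s \<theta>))" and
      d: "(g has_derivative (\<lambda>v. \<Sum>j\<in>UNIV. d $ j * v $ j)) (at (a + \<zeta> *s \<theta>))"
      using hg ball[OF \<zeta>] unfolding holomorphic_vec_on_def by blast
    have "deriv H \<zeta> = (\<Sum>j\<in>UNIV. c $ j * \<theta> $ j)"
      unfolding H_def[abs_def]
      using has_field_derivative_restrict_line[OF c] by (rule DERIV_imp_deriv)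
    moreover have "deriv G \<zeta> = (\<Sum>j\<in>UNIV. d $ j * \<theta> $ j)"
      unfolding G_def[abs_def]
      using has_field_derivative_restrict_line[OF d] by (rule DERIV_imp_deriv)
    ultimately show ?thesis
      using grad_of_holomorphic_parts[OF f open_ball ball[OF \<zeta>] c d]
      by (simp add: hinner_def cnj_vec_def)
  qed
  have w: "w \<in> ball 0 r"
    using r by simp
  have qr': "cmod (deriv G \<zeta>) \<le> k * cmod (deriv H \<zeta>)" if "\<zeta> \<in> ball 0 r" for \<zeta>
    using qr[OF ball[OF that]] derivs[OF that] by simp
  have less1: "cmod (H \<zeta> + cnj (G \<zeta>)) < 1" if "\<zeta> \<in> ball 0 r" for \<zeta>
    using assms(4)[OF ball[OF that]] f[OF ball[OF that]] by (simp add: H_def G_def)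
  have fz: "H w + cnj (G w) = f z"
    using f[OF assms(6)] z by (simp add: H_def G_def)
  have "r\<^sup>2 - (cmod w)\<^sup>2 = 1 - (norm z)\<^sup>2"
    using r2 nz by simp
  then have "(1 - k) * cmod (deriv H w) * (1 - (norm z)\<^sup>2) \<le> r * (1 - (cmod (f z))\<^sup>2)"
    using schwarz_pick_disc[OF hol refl assms(2) qr' less1 r(3)] fz by simp
  also have "\<dots> \<le> 1 * (1 - (cmod (f z))\<^sup>2)"
    using r(2) assms(4)[OF assms(6)]
    by (intro mult_right_mono) (auto simp: power_le_one)
  finally have "cmod (deriv H w) * ((1 - k) * (1 - (norm z)\<^sup>2)) \<le> 1 - (cmod (f z))\<^sup>2"
    by (simp add: mult_ac)
  then have "cmod (deriv H w) \<le> (1 - (cmod (f z))\<^sup>2) / ((1 - k) * (1 - (norm z)\<^sup>2))"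
    using assms(2) z1 by (simp add: pos_le_divide_eq)
  then have "(1 + k) * cmod (deriv H w)
      \<le> (1 + k) * ((1 - (cmod (f z))\<^sup>2) / ((1 - k) * (1 - (norm z)\<^sup>2)))"
    using assms(1) by (intro mult_left_mono) auto
  moreover have "cmod (deriv G w) + cmod (deriv H w) \<le> (1 + k) * cmod (deriv H w)"
    using qr'[OF w] by (simp add: algebra_simps)
  moreover have "hinner (grad f z) (cnj_vec \<theta>) = deriv H w"
    "hinner (grad_bar f z) \<theta> = cnj (deriv G w)"
    using derivs[OF w] z by simp_all
  ultimately show ?thesis
    by simp
qed

end
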